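(* Let $(X,M,\ast)$ be a compact fuzzy metric space, where $\ast$ is the \L ukasiewicz t-norm, and let $P(X)$ be the set of Borel probability measures on $X$. Then the function $\hat M\colon P(X)\times P(X)\times(0,\infty)\to[0,1]$ defined by $$\hat M(\mu,\nu,t)=1-\inf\{r\in(0,1)\mid \mu(A)\le\nu(A^{r,t})+r \text{ and } \nu(A)\le\mu(A^{r,t})+r \text{ for every Borel subset } A\subset X\}$$ is a fuzzy metric (with respect to $\ast$) on the set $P(X)$.
   Context: The \L ukasiewicz t-norm is $x\ast y=\max\{x+y-1,0\}$ for $x,y\in[0,1]$. A fuzzy metric (in the sense of George and Veeramani) with respect to $\ast$ on a set $Z$ is a function $N\colon Z\times Z\times(0,\infty)\to[0,1]$ such that for all $x,y,z\in Z$ and $s,t>0$: (i) $N(x,y,t)>0$; (ii) $N(x,y,t)=1$ if and only if $x=y$; (iii) $N(x,y,t)=N(y,x,t)$; (iv) $N(x,y,t)\ast N(y,z,s)\le N(x,z,t+s)$; (v) $N(x,y,-)\colon(0,\infty)\to(0,1]$ is continuous. Then $(Z,N,\ast)$ is called a fuzzy metric space. For a fuzzy metric space $(X,M,\ast)$, $x\in X$, $r\in(0,1)$, $t>0$, the open ball is $B(x,r,t)=\{y\in X\mid M(x,y,t)>1-r\}$. The open balls form a base of a (metrizable) topology $\tau_M$ on $X$; compactness and Borel sets refer to $\tau_M$. For $A\subset X$, $A^{r,t}=\bigcup\{B(x,r,t)\mid x\in A\}$. The set over which the infimum in the definition of $\hat M$ is taken is nonempty for all $\mu,\nu,t$, so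 $\hat M$ is well defined. *)

theory Defs
  imports "HOL-Probability.Probability"
begin

definition lukasiewicz :: "real \<Rightarrow> real \<Rightarrow> real"
  where "lukasiewicz x y = max (x + y - 1) 0"

text \<open>
  Fuzzy metrics in the sense of George and Veeramani with respect to the Lukasiewicz t-norm,
  on an explicit carrier set \<open>Z\<close>. Values of \<open>N\<close> outside
  \<open>Z \<times> Z \<times> (0, \<infinity>)\<close> are irrelevant.
\<close>

locale fuzzy_metric_space =
  fixes Z :: "'a set" and N :: "'a \<Rightarrow> 'a \<Rightarrow> real \<Rightarrow> real"
  assumes range: "\<lbrakk>x \<in> Z; y \<in> Z; t > 0\<rbrakk> \<Longrightarrow> N x y t \<in> {0..1}"
    and pos: "\<lbrakk>x \<in> Z; y \<in> Z; t > 0\<rbrakk> \<Longrightarrow> N x y t > 0"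
    and eq_one_iff: "\<lbrakk>x \<in> Z; y \<in> Z; t > 0\<rbrakk> \<Longrightarrow> N x y t = 1 \<longleftrightarrow> x = y"
    and sym: "\<lbrakk>x \<in> Z; y \<in> Z; t > 0\<rbrakk> \<Longrightarrow> N x y t = N y x t"
    and triangle: "\<lbrakk>x \<in> Z; y \<in> Z; z \<in> Z; s > 0; t > 0\<rbrakk> \<Longrightarrow>
      lukasiewicz (N x y t) (N y z s) \<le> N x z (t + s)"
    and continuous: "\<lbrakk>x \<in> Z; y \<in> Z\<rbrakk> \<Longrightarrow> continuous_on {0<..} (N x y)"

definition fuzzy_ball ::
    "'a set \<Rightarrow> ('a \<Rightarrow> 'a \<Rightarrow> real \<Rightarrow> real) \<Rightarrow> 'a \<Rightarrow> real \<Rightarrow> real \<Rightarrow> 'a set"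
  where "fuzzy_ball X M x r t = {y \<in> X. M x y t > 1 - r}"

definition fuzzy_balls :: "'a set \<Rightarrow> ('a \<Rightarrow> 'a \<Rightarrow> real \<Rightarrow> real) \<Rightarrow> 'a set set"
  where "fuzzy_balls X M = {fuzzy_ball X M x r t |x r t. x \<in> X \<and> 0 < r \<and> r < 1 \<and> 0 < t}"

text \<open>
  The topology having the open balls as a base; that the unions of balls do form a
  topology on \<open>X\<close> is proved at the end of this theory.
\<close>

definition fuzzy_topology :: "'a set \<Rightarrow> ('a \<Rightarrow> 'a \<Rightarrow> real \<Rightarrow> real) \<Rightarrow> 'a topology"
  where "fuzzy_topology X M = topology (arbitrary union_of (\<lambda>B. B \<in> fuzzy_balls X M))"

definition fuzzy_borel :: "'a set \<Rightarrow> ('a \<Rightarrow> 'a \<Rightarrow> real \<Rightarrow> real) \<Rightarrow> 'a measure"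
  where "fuzzy_borel X M = sigma X {U. openin (fuzzy_topology X M) U}"

definition borel_probs :: "'a set \<Rightarrow> ('a \<Rightarrow> 'a \<Rightarrow> real \<Rightarrow> real) \<Rightarrow> 'a measure set"
  where "borel_probs X M = {\<mu>. prob_space \<mu> \<and> sets \<mu> = sets (fuzzy_borel X M)}"

definition fuzzy_nbhd ::
    "'a set \<Rightarrow> ('a \<Rightarrow> 'a \<Rightarrow> real \<Rightarrow> real) \<Rightarrow> 'a set \<Rightarrow> real \<Rightarrow> real \<Rightarrow> 'a set"
  where "fuzzy_nbhd X M A r t = (\<Union>x\<in>A. fuzzy_ball X M x r t)"

definition fuzzy_prokhorov ::
    "'a set \<Rightarrow> ('a \<Rightarrow> 'a \<Rightarrow> real \<Rightarrow> real) \<Rightarrow> 'a measure \<Rightarrow> 'a measure \<Rightarrow> real \<Rightarrow> real"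
  where "fuzzy_prokhorov X M \<mu> \<nu> t =
    1 - Inf {r \<in> {0<..<1}. \<forall>A \<in> sets (fuzzy_borel X M).
               measure \<mu> A \<le> measure \<nu> (fuzzy_nbhd X M A r t) + r \<and>
               measure \<nu> A \<le> measure \<mu> (fuzzy_nbhd X M A r t) + r}"

context fuzzy_metric_space
begin

lemma mono_t:
  assumes "x \<in> Z" "y \<in> Z" "0 < s" "s \<le> t"
  shows "N x y s \<le> N x y t"
proof (cases "s = t")
  case False
  then have "lukasiewicz (N x y s) (N y y (t - s)) \<le> N x y t"
    using triangle[of x y y "t - s" s] assms by simp
  moreover have "N y y (t - s) = 1"
    using eq_one_iff[of y y "t - s"] assms False by simp
  ultimately show ?thesis by (simp add: lukasiewicz_def)
qed simp

lemma ball_contains_ball: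
  assumes "x \<in> Z" "y \<in> fuzzy_ball Z N x r t" "0 < t"
  obtains e u where "0 < e" "e < 1" "0 < u"
    "\<And>e' u'. \<lbrakk>e' \<le> e; 0 < u'; u' \<le> u\<rbrakk> \<Longrightarrow> fuzzy_ball Z N y e' u' \<subseteq> fuzzy_ball Z N x r t"
proof -
  have y: "y \<in> Z" "N x y t > 1 - r"
    using assms by (auto simp: fuzzy_ball_def)
  have "isCont (N x y) t"
    using continuous[OF \<open>x \<in> Z\<close> \<open>y \<in> Z\<close>] assms
    by (simp add: continuous_on_eq_continuous_at)
  then have "(N x y \<longlongrightarrow> N x y t) (at_left t)"
    by (simp add: continuous_within filterlim_at_split)
  then have "eventually (\<lambda>s. N x y s > 1 - r) (at_left t)"
    using y order_tendstoD(1) by blast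
  moreover have "eventually (\<lambda>s. s \<in> {0<..<t}) (at_left t)"
    using assms eventually_at_left_real by blast
  ultimately have "eventually (\<lambda>s. N x y s > 1 - r \<and> s \<in> {0<..<t}) (at_left t)"
    by (rule eventually_conj)
  then obtain s where s: "N x y s > 1 - r" "0 < s" "s < t"
    using eventually_happens' trivial_limit_at_left_real by fastforce
  define e where "e = min (1/2) (N x y s - (1 - r))"
  show thesis
  proof (rule that[of e "t - s"])
    fix e' u' assume e': "e' \<le> e" "0 < u'" "u' \<le> t - s"
    show "fuzzy_ball Z N y e' u' \<subseteq> fuzzy_ball Z N x r t"
    proof
      fix z assume "z \<in> fuzzy_ball Z N y e' u'"
      then have z: "z \<in> Z" "N y z u' > 1 - e'" by (auto simp: fuzzy_ball_def)
      have "lukasiewicz (N x y s) (N y z u') \<le> N x z (s + u')"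
        using triangle[of x y z u' s] assms y z s e' by simp
      also have "\<dots> \<le> N x z t"
        using mono_t[of x z "s + u'" t] assms z s e' by simp
      finally have "N x z t > 1 - r"
        using z e' by (simp add: lukasiewicz_def e_def)
      then show "z \<in> fuzzy_ball Z N x r t" using z by (simp add: fuzzy_ball_def)
    qed
  qed (use s in \<open>auto simp: e_def\<close>)
qed

lemma centre_in_ball: "\<lbrakk>x \<in> Z; 0 < r; 0 < t\<rbrakk> \<Longrightarrow> x \<in> fuzzy_ball Z N x r t"
  using eq_one_iff[of x x t] by (simp add: fuzzy_ball_def)

lemma istopology_fuzzy: "istopology (arbitrary union_of (\<lambda>B. B \<in> fuzzy_balls Z N))"
  unfolding istopology_base_eq
proof (intro allI impI, elim conjE)
  fix S T assume S: "S \<in> fuzzy_balls Z N" and T: "T \<in> fuzzy_balls Z N"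
  have "\<exists>B. B \<in> fuzzy_balls Z N \<and> y \<in> B \<and> B \<subseteq> S \<inter> T" if y: "y \<in> S \<inter> T" for y
  proof -
    obtain x r t where x: "x \<in> Z" "0 < t" "S = fuzzy_ball Z N x r t"
      using S by (auto simp: fuzzy_balls_def)
    obtain x' r' t' where x': "x' \<in> Z" "0 < t'" "T = fuzzy_ball Z N x' r' t'"
      using T by (auto simp: fuzzy_balls_def)
    have yZ: "y \<in> Z" using y x by (simp add: fuzzy_ball_def)
    obtain e u where 1: "0 < e" "e < 1" "0 < u"
      "\<And>e' u'. \<lbrakk>e' \<le> e; 0 < u'; u' \<le> u\<rbrakk> \<Longrightarrow> fuzzy_ball Z N y e' u' \<subseteq> S"
      using ball_contains_ball[of x y r t] x y by blast
    obtain d v where 2: "0 < d" "d < 1" "0 < v"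
      "\<And>e' u'. \<lbrakk>e' \<le> d; 0 < u'; u' \<le> v\<rbrakk> \<Longrightarrow> fuzzy_ball Z N y e' u' \<subseteq> T"
      using ball_contains_ball[of x' y r' t'] x' y by blast
    let ?B = "fuzzy_ball Z N y (min e d) (min u v)"
    have "?B \<subseteq> S \<inter> T" using 1 2 by simp
    moreover have "y \<in> ?B" using centre_in_ball yZ 1 2 by simp
    moreover have "?B \<in> fuzzy_balls Z N"
      unfolding fuzzy_balls_def using yZ 1 2
      by (intro CollectI exI[of _ y] exI[of _ "min e d"] exI[of _ "min u v"]) auto
    ultimately show ?thesis by blast
  qed
  then show "(arbitrary union_of (\<lambda>B. B \<in> fuzzy_balls Z N)) (S \<inter> T)"
    unfolding arbitrary_union_of_alt by blast
qed

lemma openin_fuzzy_topology: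
  "openin (fuzzy_topology Z N) U \<longleftrightarrow> (\<exists>\<B> \<subseteq> fuzzy_balls Z N. U = \<Union>\<B>)"
  unfolding fuzzy_topology_def topology_inverse'[OF istopology_fuzzy]
  by (auto simp: union_of_def arbitrary_def)

lemma topspace_fuzzy_topology: "topspace (fuzzy_topology Z N) = Z"
proof
  show "topspace (fuzzy_topology Z N) \<subseteq> Z"
    using openin_topspace[of "fuzzy_topology Z N"]
    unfolding openin_fuzzy_topology fuzzy_balls_def fuzzy_ball_def by auto
next
  have "Z = \<Union>(fuzzy_balls Z N)"
  proof
    show "Z \<subseteq> \<Union>(fuzzy_balls Z N)"
    proof
      fix x assume "x \<in> Z"
      then have "fuzzy_ball Z N x (1/2) 1 \<in> fuzzy_balls Z N"
        unfolding fuzzy_balls_def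
        by (intro CollectI exI[of _ x] exI[of _ "1/2::real"] exI[of _ "1::real"]) auto
      moreover have "x \<in> fuzzy_ball Z N x (1/2) 1"
        using \<open>x \<in> Z\<close> by (simp add: centre_in_ball)
      ultimately show "x \<in> \<Union>(fuzzy_balls Z N)" by blast
    qed
  qed (auto simp: fuzzy_balls_def fuzzy_ball_def)
  then have "openin (fuzzy_topology Z N) Z"
    using openin_fuzzy_topology by auto
  then show "Z \<subseteq> topspace (fuzzy_topology Z N)" by (rule openin_subset)
qed

end

end

theory Submission
  imports Defs
begin

text \<open>
  The triangle inequality follows from
  \<open>(A\<^sup>r\<^sup>,\<^sup>t)\<^sup>q\<^sup>,\<^sup>s \<subseteq> A\<^sup>r\<^sup>+\<^sup>q\<^sup>,\<^sup>t\<^sup>+\<^sup>s\<close>. Compactness gives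
  \<^item> a positive lower bound for \<open>M(x, y, t)\<close> in \<open>x, y\<close>, so that some admissible radius exists;
  \<^item> that a closed set is the intersection of its neighbourhoods \<open>A\<^sup>r\<^sup>,\<^sup>t\<close>, \<open>r > 0\<close>, with \<open>t\<close> fixed,
    so that measures at distance \<open>0\<close> agree on closed sets;
  \<^item> that \<open>M(x, y, t)\<close> is continuous in \<open>t\<close> uniformly in \<open>x, y\<close>. A change of at most \<open>e\<close> in \<open>M\<close>
    changes the infimum of the radii by at most \<open>e\<close>, whence continuity in \<open>t\<close>.
\<close>

text \<open>A finite subcover leaves finitely many local bounds, and by antitonicity their minimum
  serves everywhere. All three uses of compactness reduce to this.\<close>

lemma compactin_uniform_bound:
  fixes P :: "'a \<Rightarrow> real \<Rightarrow> bool"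
  assumes K: "compactin T K"
    and local: "\<And>x. x \<in> K \<Longrightarrow> \<exists>U d. openin T U \<and> x \<in> U \<and> 0 < d \<and> (\<forall>y\<in>U. P y d)"
    and antitone: "\<And>y d d'. P y d \<Longrightarrow> 0 < d' \<Longrightarrow> d' \<le> d \<Longrightarrow> P y d'"
  shows "\<exists>d>0. \<forall>y\<in>K. P y d"
proof -
  obtain U d where U: "\<And>x. x \<in> K \<Longrightarrow> openin T (U x) \<and> x \<in> U x \<and> 0 < d x \<and> (\<forall>y\<in>U x. P y (d x))"
    using local by metis
  have "\<exists>\<F>. finite \<F> \<and> \<F> \<subseteq> U ` K \<and> K \<subseteq> \<Union>\<F>"
    by (rule compactinD[OF K]) (use U in auto)
  then obtain F where F: "finite F" "F \<subseteq> K" "K \<subseteq> \<Union>(U ` F)"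
    by (metis finite_subset_image)
  \<comment> \<open>Inserting \<open>1\<close> keeps \<open>Min\<close> meaningful when
    \<open>F\<close> is empty, which happens for empty \<open>K\<close>.\<close>
  define m where "m = Min (insert 1 (d ` F))"
  have "0 < m"
    unfolding m_def using F U by (subst Min_gr_iff) auto
  moreover have "P y m" if "y \<in> K" for y
  proof -
    from that F obtain x where x: "x \<in> F" "y \<in> U x" by blast
    then have "m \<le> d x" unfolding m_def using F by (intro Min_le) auto
    with x F U \<open>0 < m\<close> antitone show ?thesis by blast
  qed
  ultimately show ?thesis by blast
qed

context fuzzy_metric_space
begin

section \<open>Open balls, neighbourhoods and Borel sets\<close>

lemma le_one: "\<lbrakk>x \<in> Z; y \<in> Z; 0 < t\<rbrakk> \<Longrightarrow> N x y t \<le> 1"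
  using range[of x y t] by simp

lemma triangle_add:
  "\<lbrakk>x \<in> Z; y \<in> Z; z \<in> Z; 0 < s; 0 < t\<rbrakk> \<Longrightarrow> N x y t + N y z s - 1 \<le> N x z (t + s)"
  using triangle[of x y z s t] by (simp add: lukasiewicz_def)

text \<open>Since \<open>r\<close> is any real, the ball need not belong to the base; openness comes
  from the smaller base balls around its points.\<close>

lemma openin_fuzzy_ball:
  assumes "x \<in> Z" "0 < t"
  shows "openin (fuzzy_topology Z N) (fuzzy_ball Z N x r t)"
proof (subst openin_subopen, intro ballI)
  fix y assume y: "y \<in> fuzzy_ball Z N x r t"
  then have yZ: "y \<in> Z" by (simp add: fuzzy_ball_def)
  obtain e u where eu: "0 < e" "e < 1" "0 < u"
    and sub: "\<And>e' u'. \<lbrakk>e' \<le> e; 0 < u'; u' \<le> u\<rbrakk> \<Longrightarrow> fuzzy_ball Z N y e' u' \<subseteq> fuzzy_ball Z N x r t"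
    using ball_contains_ball[OF assms(1) y assms(2)] by blast
  have "openin (fuzzy_topology Z N) (fuzzy_ball Z N y e u)"
    unfolding openin_fuzzy_topology
    using yZ eu by (intro exI[of _ "{fuzzy_ball Z N y e u}"]) (auto simp: fuzzy_balls_def)
  then show "\<exists>T. openin (fuzzy_topology Z N) T \<and> y \<in> T \<and> T \<subseteq> fuzzy_ball Z N x r t"
    using centre_in_ball[OF yZ] eu sub[of e u] by auto
qed

lemma openin_fuzzy_nbhd:
  "\<lbrakk>A \<subseteq> Z; 0 < t\<rbrakk> \<Longrightarrow> openin (fuzzy_topology Z N) (fuzzy_nbhd Z N A r t)"
  unfolding fuzzy_nbhd_def using openin_fuzzy_ball by (intro openin_Union) auto

lemma sets_fuzzy_borel:
  "sets (fuzzy_borel Z N) = sigma_sets Z {U. openin (fuzzy_topology Z N) U}"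
  unfolding fuzzy_borel_def
  by (rule sets_measure_of) (use openin_subset topspace_fuzzy_topology in blast)

lemma space_fuzzy_borel: "space (fuzzy_borel Z N) = Z"
  unfolding fuzzy_borel_def
  by (rule space_measure_of) (use openin_subset topspace_fuzzy_topology in blast)

lemma fuzzy_borel_subset: "A \<in> sets (fuzzy_borel Z N) \<Longrightarrow> A \<subseteq> Z"
  using sets.sets_into_space space_fuzzy_borel by blast

lemma openin_imp_fuzzy_borel:
  "openin (fuzzy_topology Z N) U \<Longrightarrow> U \<in> sets (fuzzy_borel Z N)"
  unfolding sets_fuzzy_borel by blast

text \<open>Neighbourhoods are unions of open balls. Measurability matters because
  \<open>measure\<close> takes the default value 0 outside \<open>sets\<close>.\<close>

lemma fuzzy_nbhd_in_sets:
  "\<lbrakk>A \<in> sets (fuzzy_borel Z N); 0 < t\<rbrakk> \<Longrightarrow> fuzzy_nbhd Z N A r t \<in> sets (fuzzy_borel Z N)"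
  using openin_imp_fuzzy_borel[OF openin_fuzzy_nbhd[OF fuzzy_borel_subset]] .

lemma subset_fuzzy_nbhd: "\<lbrakk>A \<subseteq> Z; 0 < r; 0 < t\<rbrakk> \<Longrightarrow> A \<subseteq> fuzzy_nbhd Z N A r t"
  using centre_in_ball by (fastforce simp: fuzzy_nbhd_def)

text \<open>The additive form covers two uses: enlarging the radius at a fixed time, and changing
  the time while the radius pays for the change in \<open>N\<close>.\<close>

lemma fuzzy_nbhd_subset:
  assumes "A \<subseteq> Z" and le: "\<And>x y. \<lbrakk>x \<in> Z; y \<in> Z\<rbrakk> \<Longrightarrow> N x y t + r \<le> N x y s + q"
  shows "fuzzy_nbhd Z N A r t \<subseteq> fuzzy_nbhd Z N A q s"
proof
  fix y assume "y \<in> fuzzy_nbhd Z N A r t"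
  then obtain x where x: "x \<in> A" "x \<in> Z" "y \<in> Z" "N x y t > 1 - r"
    using \<open>A \<subseteq> Z\<close> by (auto simp: fuzzy_nbhd_def fuzzy_ball_def)
  with le[of x y] have "N x y s > 1 - q" by linarith
  with x show "y \<in> fuzzy_nbhd Z N A q s"
    by (auto simp: fuzzy_nbhd_def fuzzy_ball_def)
qed

text \<open>For the Lukasiewicz t-norm the deficits \<open>r\<close> and \<open>q\<close> from the
  value 1 simply add along the triangle inequality.\<close>

lemma fuzzy_nbhd_nbhd:
  assumes "A \<subseteq> Z" "0 < t" "0 < s"
  shows "fuzzy_nbhd Z N (fuzzy_nbhd Z N A r t) q s \<subseteq> fuzzy_nbhd Z N A (r + q) (t + s)"
proof
  fix z assume "z \<in> fuzzy_nbhd Z N (fuzzy_nbhd Z N A r t) q s"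
  then obtain x y where "x \<in> A" "y \<in> Z" "z \<in> Z" "N x y t > 1 - r" "N y z s > 1 - q"
    by (auto simp: fuzzy_nbhd_def fuzzy_ball_def)
  with triangle_add[of x y z s t] assms show "z \<in> fuzzy_nbhd Z N A (r + q) (t + s)"
    by (force simp: fuzzy_nbhd_def fuzzy_ball_def)
qed

lemma borel_probsD:
  assumes "\<mu> \<in> borel_probs Z N"
  shows "prob_space \<mu>" "sets \<mu> = sets (fuzzy_borel Z N)" "space \<mu> = Z"
  using assms sets_eq_imp_space_eq[of \<mu> "fuzzy_borel Z N"]
  by (auto simp: borel_probs_def space_fuzzy_borel)

lemma measure_mono_borel:
  assumes "\<mu> \<in> borel_probs Z N" "A \<subseteq> B" "B \<in> sets (fuzzy_borel Z N)"
  shows "measure \<mu> A \<le> measure \<mu> B"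
  using assms borel_probsD[OF assms(1)]
  by (simp add: finite_measure.finite_measure_mono prob_space_def)

section \<open>The admissible radii\<close>

definition prokhorov_radii :: "'a measure \<Rightarrow> 'a measure \<Rightarrow> real \<Rightarrow> real set"
  where "prokhorov_radii \<mu> \<nu> t = {r \<in> {0<..<1}. \<forall>A \<in> sets (fuzzy_borel Z N).
    measure \<mu> A \<le> measure \<nu> (fuzzy_nbhd Z N A r t) + r \<and>
    measure \<nu> A \<le> measure \<mu> (fuzzy_nbhd Z N A r t) + r}"

lemma fuzzy_prokhorov_radii: "fuzzy_prokhorov Z N \<mu> \<nu> t = 1 - Inf (prokhorov_radii \<mu> \<nu> t)"
  by (simp add: fuzzy_prokhorov_def prokhorov_radii_def)

lemma prokhorov_radii_commute: "prokhorov_radii \<mu> \<nu> t = prokhorov_radii \<nu> \<mu> t"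
  unfolding prokhorov_radii_def by (intro Collect_cong) blast

lemma prokhorov_radiiD: "r \<in> prokhorov_radii \<mu> \<nu> t \<Longrightarrow> 0 < r \<and> r < 1"
  by (simp add: prokhorov_radii_def)

lemma bdd_below_prokhorov_radii: "bdd_below (prokhorov_radii \<mu> \<nu> t)"
  using prokhorov_radiiD by (meson bdd_belowI less_imp_le)

text \<open>With \<open>s = t\<close> this gives upward closure of the admissible radii below 1;
  with \<open>s\<close> different from \<open>t\<close> it compares two times.\<close>

lemma prokhorov_radii_transfer:
  assumes "\<mu> \<in> borel_probs Z N" "\<nu> \<in> borel_probs Z N"
    and "r \<in> prokhorov_radii \<mu> \<nu> t" "r \<le> q" "q < 1" "0 < s"
    and sub: "\<And>A. A \<in> sets (fuzzy_borel Z N) \<Longrightarrow> fuzzy_nbhd Z N A r t \<subseteq> fuzzy_nbhd Z N A q s"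
  shows "q \<in> prokhorov_radii \<mu> \<nu> s"
proof -
  have "measure \<mu> A \<le> measure \<nu> (fuzzy_nbhd Z N A q s) + q \<and>
      measure \<nu> A \<le> measure \<mu> (fuzzy_nbhd Z N A q s) + q"
    if A: "A \<in> sets (fuzzy_borel Z N)" for A
  proof -
    have "measure \<mu> A \<le> measure \<nu> (fuzzy_nbhd Z N A r t) + r"
      "measure \<nu> A \<le> measure \<mu> (fuzzy_nbhd Z N A r t) + r"
      using assms(3) A by (auto simp: prokhorov_radii_def)
    moreover have "measure \<mu> (fuzzy_nbhd Z N A r t) \<le> measure \<mu> (fuzzy_nbhd Z N A q s)"
      "measure \<nu> (fuzzy_nbhd Z N A r t) \<le> measure \<nu> (fuzzy_nbhd Z N A q s)"
      using measure_mono_borel assms(1,2,6) sub[OF A] fuzzy_nbhd_in_sets[OF A] by auto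
    ultimately show ?thesis using \<open>r \<le> q\<close> by linarith
  qed
  with assms(4,5) prokhorov_radiiD[OF assms(3)] show ?thesis
    by (simp add: prokhorov_radii_def)
qed

text \<open>The middle measure is tested on the neighbourhood of \<open>A\<close>, whose own
  neighbourhood is then bounded by \<open>fuzzy_nbhd_nbhd\<close>.\<close>

lemma prokhorov_radii_triangle:
  assumes "\<mu> \<in> borel_probs Z N" "\<nu> \<in> borel_probs Z N" "\<kappa> \<in> borel_probs Z N" "0 < t" "0 < s"
    and r: "r \<in> prokhorov_radii \<mu> \<nu> t" and q: "q \<in> prokhorov_radii \<nu> \<kappa> s" and "r + q < 1"
  shows "r + q \<in> prokhorov_radii \<mu> \<kappa> (t + s)"
proof -
  \<comment> \<open>Radii and times are generic because the reverse inequality runs from \<kappa> to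
    \<mu> and uses \<open>q\<close>, \<open>s\<close> before \<open>r\<close>, \<open>t\<close>;
    only the sums agree.\<close>
  have half: "measure \<alpha> A \<le> measure \<gamma> (fuzzy_nbhd Z N A (r + q) (t + s)) + (r + q)"
    if \<gamma>: "\<gamma> \<in> borel_probs Z N" and A: "A \<in> sets (fuzzy_borel Z N)"
      and pq: "r' + q' = r + q" "t' + s' = t + s" "0 < t'" "0 < s'"
      and r': "r' \<in> prokhorov_radii \<alpha> \<beta> t'" and q': "q' \<in> prokhorov_radii \<beta> \<gamma> s'"
    for \<alpha> \<beta> \<gamma> A r' q' t' s'
  proof -
    let ?B = "fuzzy_nbhd Z N A r' t'"
    have "measure \<alpha> A \<le> measure \<beta> ?B + r'"
      using r' A by (simp add: prokhorov_radii_def)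
    also have "measure \<beta> ?B \<le> measure \<gamma> (fuzzy_nbhd Z N ?B q' s') + q'"
      using q' fuzzy_nbhd_in_sets[OF A \<open>0 < t'\<close>] by (simp add: prokhorov_radii_def)
    also have "measure \<gamma> (fuzzy_nbhd Z N ?B q' s')
        \<le> measure \<gamma> (fuzzy_nbhd Z N A (r + q) (t + s))"
      using fuzzy_nbhd_nbhd[OF fuzzy_borel_subset[OF A] pq(3,4), of r' q'] pq(1,2) assms(4,5)
      by (intro measure_mono_borel[OF \<gamma>] fuzzy_nbhd_in_sets[OF A]) auto
    finally show ?thesis using pq by simp
  qed
  have "measure \<mu> A \<le> measure \<kappa> (fuzzy_nbhd Z N A (r + q) (t + s)) + (r + q) \<and>
      measure \<kappa> A \<le> measure \<mu> (fuzzy_nbhd Z N A (r + q) (t + s)) + (r + q)"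
    if A: "A \<in> sets (fuzzy_borel Z N)" for A
    using half[OF assms(3) A _ _ _ _ r q]
      half[OF assms(1) A _ _ _ _ q[unfolded prokhorov_radii_commute[of \<nu>]]
        r[unfolded prokhorov_radii_commute[of \<mu>]]] assms(4,5)
    by (simp add: add.commute)
  with assms(8) prokhorov_radiiD[OF r] prokhorov_radiiD[OF q] show ?thesis
    by (simp add: prokhorov_radii_def)
qed

end

section \<open>Consequences of compactness\<close>

locale compact_fuzzy_metric_space = fuzzy_metric_space +
  assumes compact: "compact_space (fuzzy_topology Z N)"
begin

text \<open>This is \<open>compactin_uniform_bound\<close> on \<open>Z \<times> Z\<close>, which is
  compact in the product topology and has products of balls as open neighbourhoods.\<close>

lemma uniform_bound_pairs:
  fixes P :: "'a \<Rightarrow> 'a \<Rightarrow> real \<Rightarrow> bool"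
  assumes local: "\<And>a b. \<lbrakk>a \<in> Z; b \<in> Z\<rbrakk> \<Longrightarrow> \<exists>e>0. \<exists>u>0. \<exists>d>0.
      \<forall>x\<in>fuzzy_ball Z N a e u. \<forall>y\<in>fuzzy_ball Z N b e u. P x y d"
    and antitone: "\<And>x y d d'. P x y d \<Longrightarrow> 0 < d' \<Longrightarrow> d' \<le> d \<Longrightarrow> P x y d'"
  shows "\<exists>d>0. \<forall>x\<in>Z. \<forall>y\<in>Z. P x y d"
proof -
  let ?T = "fuzzy_topology Z N"
  have "compactin (prod_topology ?T ?T) (Z \<times> Z)"
    using compact topspace_fuzzy_topology by (simp add: compactin_Times compact_space_def)
  then have "\<exists>d>0. \<forall>p\<in>Z \<times> Z. case p of (x, y) \<Rightarrow> P x y d"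
  proof (rule compactin_uniform_bound)
    fix p assume "p \<in> Z \<times> Z"
    then obtain a b where ab: "p = (a, b)" "a \<in> Z" "b \<in> Z" by blast
    then obtain e u d where eud: "0 < e" "0 < u" "0 < d"
      "\<forall>x\<in>fuzzy_ball Z N a e u. \<forall>y\<in>fuzzy_ball Z N b e u. P x y d"
      using local by blast
    show "\<exists>U d. openin (prod_topology ?T ?T) U \<and> p \<in> U \<and> 0 < d \<and>
        (\<forall>p\<in>U. case p of (x, y) \<Rightarrow> P x y d)"
      by (rule exI[of _ "fuzzy_ball Z N a e u \<times> fuzzy_ball Z N b e u"], rule exI[of _ d])
        (use eud ab openin_fuzzy_ball centre_in_ball in \<open>auto simp: openin_prod_Times_iff\<close>)
  qed (use antitone in auto)
  then show ?thesis by auto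
qed

text \<open>The time is split into three: near \<open>(a, b)\<close>, moving each endpoint costs at
  most a third of the positive number \<open>N a b (t/3)\<close>, so a third of it remains.\<close>

lemma lower_bound:
  assumes "0 < t"
  shows "\<exists>c>0. \<forall>x\<in>Z. \<forall>y\<in>Z. c \<le> N x y t"
proof (rule uniform_bound_pairs)
  fix a b assume ab: "a \<in> Z" "b \<in> Z"
  define m where "m = N a b (t/3)"
  have "0 < m" using pos ab assms by (simp add: m_def)
  have "m/3 \<le> N x y t" if "x \<in> fuzzy_ball Z N a (m/3) (t/3)" "y \<in> fuzzy_ball Z N b (m/3) (t/3)" for x y
  proof -
    have x: "x \<in> Z" "N a x (t/3) > 1 - m/3" and y: "y \<in> Z" "N b y (t/3) > 1 - m/3"
      using that by (auto simp: fuzzy_ball_def)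
    have "N x a (t/3) + N a b (t/3) - 1 \<le> N x b (t/3 + t/3)"
      using triangle_add[of x a b "t/3" "t/3"] x ab assms by simp
    moreover have "N x b (t/3 + t/3) + N b y (t/3) - 1 \<le> N x y (t/3 + t/3 + t/3)"
      using triangle_add[of x b y "t/3" "t/3 + t/3"] x y ab assms by simp
    moreover have "N x a (t/3) = N a x (t/3)"
      using sym x ab assms by simp
    ultimately show ?thesis using x y by (simp add: m_def)
  qed
  moreover have "0 < m/3" "0 < t/3" using \<open>0 < m\<close> assms by auto
  ultimately show "\<exists>e>0. \<exists>u>0. \<exists>d>0.
      \<forall>x\<in>fuzzy_ball Z N a e u. \<forall>y\<in>fuzzy_ball Z N b e u. d \<le> N x y t"
    by blast
qed auto

text \<open>Since \<open>N\<close> increases in time, one inequality between the endpoints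
  \<open>t - d\<close> and \<open>t + d\<close> controls the variation on the whole interval. Near
  \<open>(a, b)\<close>, the values of \<open>N x y\<close> at \<open>t - u\<close> and
  \<open>t + u\<close> are compared with those of \<open>N a b\<close> at \<open>t - 3 * u\<close>
  and \<open>t + 3 * u\<close>. Each comparison costs \<open>e/3\<close>, and continuity of
  \<open>N a b\<close> costs the last \<open>e/3\<close>.\<close>

lemma uniformly_continuous_t:
  assumes "0 < t" "0 < e"
  shows "\<exists>d>0. d < t \<and> (\<forall>x\<in>Z. \<forall>y\<in>Z. N x y (t + d) \<le> N x y (t - d) + e)"
proof -
  \<comment> \<open>The guard makes \<open>P\<close> antitone in \<open>d\<close> for all
    \<open>x\<close>, \<open>y\<close>, since \<open>mono_t\<close> applies only inside
    \<open>Z\<close>; the conjunct \<open>d < t\<close> keeps \<open>t - d\<close> positive.\<close>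
  define P where "P x y d \<longleftrightarrow> x \<in> Z \<and> y \<in> Z \<longrightarrow> d < t \<and> N x y (t + d) \<le> N x y (t - d) + e" for x y d
  have "\<exists>d>0. \<forall>x\<in>Z. \<forall>y\<in>Z. P x y d"
  proof (rule uniform_bound_pairs)
    fix x y d d' assume P: "P x y d" "0 < d'" "d' \<le> d"
    show "P x y d'"
      using P mono_t[of x y "t + d'" "t + d"] mono_t[of x y "t - d" "t - d'"] assms
      by (auto simp: P_def)
  next
    fix a b assume ab: "a \<in> Z" "b \<in> Z"
    have "isCont (N a b) t"
      using continuous[OF ab] assms by (simp add: continuous_on_eq_continuous_at)
    then obtain h where h: "0 < h" "\<And>s. \<bar>s - t\<bar> < h \<Longrightarrow> \<bar>N a b s - N a b t\<bar> < e/6"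
      using assms(2) unfolding continuous_at_eps_delta dist_real_def
      by (metis zero_less_divide_iff zero_less_numeral)
    \<comment> \<open>The factor 4 keeps \<open>t - 3 * u\<close> positive and both outer times
      within the window \<open>h\<close>.\<close>
    define u where "u = min h t / 4"
    have u: "0 < u" "3 * u < h" "3 * u < t"
      using h assms by (auto simp: u_def)
    have "P x y u" if "x \<in> fuzzy_ball Z N a (e/6) u" "y \<in> fuzzy_ball Z N b (e/6) u" for x y
    proof -
      have x: "x \<in> Z" "N a x u > 1 - e/6" and y: "y \<in> Z" "N b y u > 1 - e/6"
        using that by (auto simp: fuzzy_ball_def)
      have s: "N x a u = N a x u" "N y b u = N b y u"
        using sym x y ab u by auto
      have "N x a u + N a b (t - 3 * u) - 1 \<le> N x b (u + (t - 3 * u))"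
        using x ab u by (intro triangle_add) auto
      moreover have "N x b (u + (t - 3 * u)) + N b y u - 1 \<le> N x y (u + (t - 3 * u) + u)"
        using x y ab u by (intro triangle_add) auto
      moreover have "N a x u + N x y (t + u) - 1 \<le> N a y (u + (t + u))"
        using x y ab u by (intro triangle_add) auto
      moreover have "N a y (u + (t + u)) + N y b u - 1 \<le> N a b (u + (t + u) + u)"
        using x y ab u by (intro triangle_add) auto
      moreover have "\<bar>N a b (t - 3 * u) - N a b t\<bar> < e/6" "\<bar>N a b (t + 3 * u) - N a b t\<bar> < e/6"
        using h(2) u by auto
      moreover have "u + (t - 3 * u) + u = t - u" "u + (t + u) + u = t + 3 * u" by auto
      ultimately have "N x y (t + u) \<le> N x y (t - u) + e"
        using x y s by (simp only:)
      then show ?thesis using u by (simp add: P_def)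
    qed
    moreover have "0 < e/6" using assms(2) by simp
    ultimately show "\<exists>e>0. \<exists>u>0. \<exists>d>0.
        \<forall>x\<in>fuzzy_ball Z N a e u. \<forall>y\<in>fuzzy_ball Z N b e u. P x y d"
      using \<open>0 < u\<close> by blast
  qed
  then obtain d where "0 < d" "\<forall>x\<in>Z. \<forall>y\<in>Z. P x y d" by blast
  \<comment> \<open>For empty \<open>Z\<close> the property \<open>P\<close> says nothing, so
    \<open>d < t\<close> has to be arranged separately.\<close>
  then show ?thesis
  proof (cases "Z = {}")
    case True
    then show ?thesis using assms(1) dense by auto
  next
    case False
    with \<open>0 < d\<close> \<open>\<forall>x\<in>Z. \<forall>y\<in>Z. P x y d\<close> show ?thesis
      by (intro exI[of _ d]) (auto simp: P_def)
  qed
qed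

text \<open>For \<open>y\<close> outside \<open>A\<close>, compactness of \<open>A\<close> turns the
  pointwise gap \<open>N z y t < 1\<close> into a uniform gap \<open>d\<close>, so the neighbourhood
  of radius \<open>d\<close> misses \<open>y\<close>.\<close>

lemma closedin_eq_Inter_fuzzy_nbhd:
  assumes A: "closedin (fuzzy_topology Z N) A" and "0 < t"
  shows "(\<Inter>r\<in>{0<..}. fuzzy_nbhd Z N A r t) = A"
proof
  have AZ: "A \<subseteq> Z" using closedin_subset[OF A] topspace_fuzzy_topology by simp
  then show "A \<subseteq> (\<Inter>r\<in>{0<..}. fuzzy_nbhd Z N A r t)"
    using subset_fuzzy_nbhd[OF _ _ \<open>0 < t\<close>] by (intro INT_greatest) simp
  show "(\<Inter>r\<in>{0<..}. fuzzy_nbhd Z N A r t) \<subseteq> A"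
  proof (rule subsetI, rule ccontr)
    fix y assume y: "y \<in> (\<Inter>r\<in>{0<..}. fuzzy_nbhd Z N A r t)" and "y \<notin> A"
    have "y \<in> fuzzy_nbhd Z N A 1 t" using y by simp
    then have yZ: "y \<in> Z" by (auto simp: fuzzy_nbhd_def fuzzy_ball_def)
    have "\<exists>d>0. \<forall>z\<in>A. z \<in> Z \<longrightarrow> N z y t \<le> 1 - d"
    proof (rule compactin_uniform_bound)
      show "compactin (fuzzy_topology Z N) A"
        using A compact closedin_compact_space by blast
    next
      fix x assume x: "x \<in> A"
      then have xZ: "x \<in> Z" using AZ by blast
      \<comment> \<open>Half of the gap at time \<open>t + t\<close> absorbs the move from
        \<open>x\<close> to a nearby \<open>z\<close>; the other half is left as the gap of
        \<open>z\<close> at time \<open>t\<close>.\<close>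
      define e where "e = (1 - N x y (t + t)) / 2"
      have "N x y (t + t) \<noteq> 1" "N x y (t + t) \<le> 1"
        using eq_one_iff le_one x \<open>y \<notin> A\<close> xZ yZ \<open>0 < t\<close> by auto
      then have "0 < e" by (simp add: e_def)
      have "N z y t \<le> 1 - e" if "z \<in> fuzzy_ball Z N x e t" for z
        using that triangle_add[of x z y t t] xZ yZ \<open>0 < t\<close>
        by (auto simp: fuzzy_ball_def e_def field_simps)
      then show "\<exists>U d. openin (fuzzy_topology Z N) U \<and> x \<in> U \<and> 0 < d \<and>
          (\<forall>z\<in>U. z \<in> Z \<longrightarrow> N z y t \<le> 1 - d)"
        using \<open>0 < e\<close> openin_fuzzy_ball[OF xZ \<open>0 < t\<close>] centre_in_ball[OF xZ _ \<open>0 < t\<close>]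
        by (intro exI[of _ "fuzzy_ball Z N x e t"] exI[of _ e]) simp
    qed auto
    then obtain d where "0 < d" "\<forall>z\<in>A. N z y t \<le> 1 - d" using AZ by blast
    then show False
      using y by (force simp: fuzzy_nbhd_def fuzzy_ball_def)
  qed
qed

section \<open>The infimum of the admissible radii\<close>

text \<open>Once \<open>1 - r\<close> is below the uniform lower bound of \<open>N\<close>, the
  neighbourhood of any nonempty set is all of \<open>Z\<close> and has measure 1.\<close>

lemma prokhorov_radii_nonempty:
  assumes "\<mu> \<in> borel_probs Z N" "\<nu> \<in> borel_probs Z N" "0 < t"
  shows "prokhorov_radii \<mu> \<nu> t \<noteq> {}"
proof -
  obtain c where c: "0 < c" "\<forall>x\<in>Z. \<forall>y\<in>Z. c \<le> N x y t"
    using lower_bound[OF \<open>0 < t\<close>] by blast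
  \<comment> \<open>The \<open>min\<close> keeps \<open>r\<close> positive even if \<open>c\<close>
    is large.\<close>
  define r where "r = 1 - min c 1 / 2"
  have r: "0 < r" "r < 1" "1 - r < c" using c by (auto simp: r_def)
  have "measure \<alpha> A \<le> measure \<beta> (fuzzy_nbhd Z N A r t) + r"
    if "\<alpha> \<in> borel_probs Z N" "\<beta> \<in> borel_probs Z N" "A \<in> sets (fuzzy_borel Z N)" for \<alpha> \<beta> A
  proof (cases "A = {}")
    case False
    note \<alpha> = borel_probsD[OF that(1)] and \<beta> = borel_probsD[OF that(2)]
    have "fuzzy_nbhd Z N A r t = Z"
      using False fuzzy_borel_subset[OF that(3)] c r
      by (force simp: fuzzy_nbhd_def fuzzy_ball_def)
    then have "measure \<beta> (fuzzy_nbhd Z N A r t) = 1"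
      using \<beta> prob_space.prob_space by metis
    moreover have "measure \<alpha> A \<le> 1" using \<alpha>(1) prob_space.prob_le_1 by blast
    ultimately show ?thesis using r by simp
  qed (use r in simp)
  with assms r show ?thesis by (auto simp: prokhorov_radii_def)
qed

text \<open>A single admissible radius, being below 1, already gives the strict bound, which yields
  positivity of \<open>fuzzy_prokhorov\<close>.\<close>

lemma Inf_prokhorov_radii_bounds:
  assumes "\<mu> \<in> borel_probs Z N" "\<nu> \<in> borel_probs Z N" "0 < t"
  shows "0 \<le> Inf (prokhorov_radii \<mu> \<nu> t)" "Inf (prokhorov_radii \<mu> \<nu> t) < 1"
proof -
  note ne = prokhorov_radii_nonempty[OF assms]
  show "0 \<le> Inf (prokhorov_radii \<mu> \<nu> t)"
    using ne prokhorov_radiiD by (intro cInf_greatest) (auto intro: less_imp_le)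
  show "Inf (prokhorov_radii \<mu> \<nu> t) < 1"
    using ne prokhorov_radiiD cInf_lessD cInf_lower[OF _ bdd_below_prokhorov_radii]
    by (meson all_not_in_conv le_less_trans)
qed

text \<open>Arbitrarily small radii are admissible, and continuity of \<nu> from above applies to
  the neighbourhoods shrinking to \<open>A\<close>.\<close>

lemma measure_le_on_closed:
  assumes \<mu>: "\<mu> \<in> borel_probs Z N" and \<nu>: "\<nu> \<in> borel_probs Z N" and "0 < t"
    and Inf: "Inf (prokhorov_radii \<mu> \<nu> t) = 0"
    and A: "closedin (fuzzy_topology Z N) A"
  shows "measure \<mu> A \<le> measure \<nu> A"
proof -
  interpret \<nu>: prob_space \<nu> using borel_probsD[OF \<nu>] by simp
  have AZ: "A \<subseteq> Z" using closedin_subset[OF A] topspace_fuzzy_topology by simp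
  have "Z - A \<in> sets (fuzzy_borel Z N)"
    using A openin_imp_fuzzy_borel topspace_fuzzy_topology by (simp add: closedin_def)
  then have "Z - (Z - A) \<in> sets (fuzzy_borel Z N)"
    using sets.compl_sets space_fuzzy_borel by metis
  then have A_sets: "A \<in> sets (fuzzy_borel Z N)"
    using AZ by (simp add: double_diff)
  \<comment> \<open>The double \<open>Suc\<close> keeps each radius strictly below 1, as membership
    in \<open>prokhorov_radii\<close> demands.\<close>
  define B where "B n = fuzzy_nbhd Z N A (1 / real (Suc (Suc n))) t" for n
  have mono: "fuzzy_nbhd Z N A r t \<subseteq> fuzzy_nbhd Z N A q t" if "r \<le> q" for r q
    using fuzzy_nbhd_subset[OF AZ] that by simp
  have "decseq B"
    unfolding B_def by (intro decseq_SucI mono) (simp add: field_simps)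
  have "(\<Inter>n. B n) \<subseteq> (\<Inter>r\<in>{0<..}. fuzzy_nbhd Z N A r t)"
  proof (rule INT_greatest)
    fix r :: real assume "r \<in> {0<..}"
    then obtain n where "1 / real (Suc n) < r"
      using nat_approx_posE by auto
    then have "1 / real (Suc (Suc n)) \<le> r"
      by (smt (verit) frac_le of_nat_0_less_iff of_nat_Suc zero_less_Suc)
    then show "(\<Inter>n. B n) \<subseteq> fuzzy_nbhd Z N A r t"
      unfolding B_def using mono by blast
  qed
  moreover have "A \<subseteq> (\<Inter>n. B n)"
    unfolding B_def using subset_fuzzy_nbhd[OF AZ] \<open>0 < t\<close> by (intro INT_greatest) simp
  ultimately have "(\<Inter>n. B n) = A"
    using closedin_eq_Inter_fuzzy_nbhd[OF A \<open>0 < t\<close>] by simp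
  moreover have "range B \<subseteq> sets \<nu>"
    unfolding B_def using fuzzy_nbhd_in_sets[OF A_sets \<open>0 < t\<close>] borel_probsD[OF \<nu>] by auto
  ultimately have lim: "(\<lambda>n. measure \<nu> (B n) + 1 / real (Suc (Suc n))) \<longlonglongrightarrow> measure \<nu> A + 0"
    using \<nu>.finite_Lim_measure_decseq[OF _ \<open>decseq B\<close>]
      LIMSEQ_Suc[OF LIMSEQ_inverse_real_of_nat]
    by (intro tendsto_add) (auto simp: inverse_eq_divide)
  have "measure \<mu> A \<le> measure \<nu> (B n) + 1 / real (Suc (Suc n))" for n
  proof -
    let ?q = "1 / real (Suc (Suc n))"
    have "Inf (prokhorov_radii \<mu> \<nu> t) < ?q" using Inf by simp
    then obtain r where "r \<in> prokhorov_radii \<mu> \<nu> t" "r < ?q"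
      using cInf_lessD[OF prokhorov_radii_nonempty[OF \<mu> \<nu> \<open>0 < t\<close>]] by blast
    then have "?q \<in> prokhorov_radii \<mu> \<nu> t"
      using prokhorov_radii_transfer[OF \<mu> \<nu>, of r t ?q t] fuzzy_nbhd_subset[OF fuzzy_borel_subset] \<open>0 < t\<close>
      by simp
    then show ?thesis using A_sets by (simp add: prokhorov_radii_def B_def)
  qed
  then show ?thesis using LIMSEQ_le_const[OF lim] by auto
qed

text \<open>Agreement on closed sets passes to open sets by complements, and the open sets form an
  intersection-stable generator of the Borel sets.\<close>

lemma eq_if_Inf_prokhorov_radii_eq_0:
  assumes \<mu>: "\<mu> \<in> borel_probs Z N" and \<nu>: "\<nu> \<in> borel_probs Z N" and "0 < t"
    and Inf: "Inf (prokhorov_radii \<mu> \<nu> t) = 0"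
  shows "\<mu> = \<nu>"
proof -
  let ?E = "{U. openin (fuzzy_topology Z N) U}"
  interpret \<mu>: prob_space \<mu> using borel_probsD[OF \<mu>] by simp
  interpret \<nu>: prob_space \<nu> using borel_probsD[OF \<nu>] by simp
  note m = borel_probsD[OF \<mu>] and n = borel_probsD[OF \<nu>]
  have EZ: "?E \<subseteq> Pow Z" using openin_subset topspace_fuzzy_topology by blast
  have eq: "measure \<mu> U = measure \<nu> U" if U: "openin (fuzzy_topology Z N) U" for U
  proof -
    have "closedin (fuzzy_topology Z N) (Z - U)"
      using closedin_diff[OF closedin_topspace U] topspace_fuzzy_topology by simp
    then have "measure \<mu> (Z - U) = measure \<nu> (Z - U)"
      using measure_le_on_closed[OF \<mu> \<nu> \<open>0 < t\<close>] measure_le_on_closed[OF \<nu> \<mu> \<open>0 < t\<close>] Inf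
      by (simp add: prokhorov_radii_commute[of \<nu>] order_antisym)
    moreover have "U \<in> sets (fuzzy_borel Z N)" using U by (rule openin_imp_fuzzy_borel)
    ultimately show ?thesis
      using \<mu>.prob_compl[of U] \<nu>.prob_compl[of U] m n by simp
  qed
  show ?thesis
  proof (rule measure_eqI_generator_eq[where E = ?E and \<Omega> = Z and A = "\<lambda>_. Z"])
    show "Int_stable ?E" by (auto simp: Int_stable_def)
    show "range (\<lambda>_. Z) \<subseteq> ?E"
      using openin_topspace[of "fuzzy_topology Z N"] topspace_fuzzy_topology by auto
    show "emeasure \<mu> U = emeasure \<nu> U" if "U \<in> ?E" for U
      using eq that by (simp add: \<mu>.emeasure_eq_measure \<nu>.emeasure_eq_measure)
  qed (use EZ m n sets_fuzzy_borel in \<open>auto simp: \<mu>.emeasure_eq_measure\<close>)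
qed

text \<open>Every Borel set lies in its own neighbourhoods, so every radius in the open unit
  interval is admissible.\<close>

lemma Inf_prokhorov_radii_self:
  assumes \<mu>: "\<mu> \<in> borel_probs Z N" and "0 < t"
  shows "Inf (prokhorov_radii \<mu> \<mu> t) = 0"
proof -
  have "r \<in> prokhorov_radii \<mu> \<mu> t" if "0 < r" "r < 1" for r
  proof -
    have "measure \<mu> A \<le> measure \<mu> (fuzzy_nbhd Z N A r t) + r"
      if "A \<in> sets (fuzzy_borel Z N)" for A
      using measure_mono_borel[OF \<mu> subset_fuzzy_nbhd[OF fuzzy_borel_subset] fuzzy_nbhd_in_sets]
        that \<open>0 < r\<close> \<open>0 < t\<close> by (smt (verit))
    with that show ?thesis by (simp add: prokhorov_radii_def)
  qed
  then have "prokhorov_radii \<mu> \<mu> t = {0<..<1}" using prokhorov_radiiD by auto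
  then show ?thesis by simp
qed

lemma Inf_prokhorov_radii_triangle:
  assumes "\<mu> \<in> borel_probs Z N" "\<nu> \<in> borel_probs Z N" "\<kappa> \<in> borel_probs Z N" "0 < t" "0 < s"
  shows "Inf (prokhorov_radii \<mu> \<kappa> (t + s))
    \<le> Inf (prokhorov_radii \<mu> \<nu> t) + Inf (prokhorov_radii \<nu> \<kappa> s)"
proof -
  let ?c = "Inf (prokhorov_radii \<mu> \<kappa> (t + s))"
  have *: "?c \<le> r + q" if "r \<in> prokhorov_radii \<mu> \<nu> t" "q \<in> prokhorov_radii \<nu> \<kappa> s" for r q
  proof (cases "r + q < 1")
    case True
    then show ?thesis
      using prokhorov_radii_triangle[OF assms that] bdd_below_prokhorov_radii
      by (intro cInf_lower) auto
  next
    \<comment> \<open>A sum of at least 1 is not admissible itself, but the infimum on the left is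
      below 1 anyway.\<close>
    case False
    then show ?thesis
      using Inf_prokhorov_radii_bounds(2)[OF assms(1,3), of "t + s"] assms(4,5) by simp
  qed
  have "?c - r \<le> Inf (prokhorov_radii \<nu> \<kappa> s)" if "r \<in> prokhorov_radii \<mu> \<nu> t" for r
    using *[OF that] prokhorov_radii_nonempty assms
    by (intro cInf_greatest) (auto simp: algebra_simps)
  then have "?c - Inf (prokhorov_radii \<nu> \<kappa> s) \<le> Inf (prokhorov_radii \<mu> \<nu> t)"
    using prokhorov_radii_nonempty assms
    by (intro cInf_greatest) (auto simp: algebra_simps)
  then show ?thesis by simp
qed

text \<open>A loss of \<open>e\<close> in \<open>N\<close> is absorbed by enlarging the radius by
  \<open>e\<close>. The bound is one-sided; continuity uses it in both directions.\<close>

lemma Inf_prokhorov_radii_perturb: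
  assumes \<mu>: "\<mu> \<in> borel_probs Z N" and \<nu>: "\<nu> \<in> borel_probs Z N" and "0 < t" "0 < s" "0 \<le> e"
    and close: "\<And>x y. \<lbrakk>x \<in> Z; y \<in> Z\<rbrakk> \<Longrightarrow> N x y t \<le> N x y s + e"
  shows "Inf (prokhorov_radii \<mu> \<nu> s) \<le> Inf (prokhorov_radii \<mu> \<nu> t) + e"
proof -
  have "Inf (prokhorov_radii \<mu> \<nu> s) - e \<le> r" if r: "r \<in> prokhorov_radii \<mu> \<nu> t" for r
  proof (cases "r + e < 1")
    case True
    have "fuzzy_nbhd Z N A r t \<subseteq> fuzzy_nbhd Z N A (r + e) s" if "A \<in> sets (fuzzy_borel Z N)" for A
      using fuzzy_nbhd_subset[OF fuzzy_borel_subset[OF that], of t r s "r + e"] close by auto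
    then have "r + e \<in> prokhorov_radii \<mu> \<nu> s"
      using True assms(4,5) by (intro prokhorov_radii_transfer[OF \<mu> \<nu> r]) auto
    then have "Inf (prokhorov_radii \<mu> \<nu> s) \<le> r + e"
      by (intro cInf_lower bdd_below_prokhorov_radii)
    then show ?thesis by simp
  next
    case False
    then show ?thesis using Inf_prokhorov_radii_bounds(2)[OF \<mu> \<nu> \<open>0 < s\<close>] by simp
  qed
  then have "Inf (prokhorov_radii \<mu> \<nu> s) - e \<le> Inf (prokhorov_radii \<mu> \<nu> t)"
    by (intro cInf_greatest prokhorov_radii_nonempty[OF \<mu> \<nu> \<open>0 < t\<close>])
  then show ?thesis by simp
qed

lemma continuous_Inf_prokhorov_radii:
  assumes \<mu>: "\<mu> \<in> borel_probs Z N" and \<nu>: "\<nu> \<in> borel_probs Z N"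
  shows "continuous_on {0<..} (\<lambda>t. Inf (prokhorov_radii \<mu> \<nu> t))"
  unfolding continuous_on_iff
proof (intro ballI allI impI)
  fix t e :: real assume "t \<in> {0<..}" "0 < e"
  then have t: "0 < t" and e: "0 < e/2" by auto
  obtain d where d: "0 < d" "d < t" "\<forall>x\<in>Z. \<forall>y\<in>Z. N x y (t + d) \<le> N x y (t - d) + e/2"
    using uniformly_continuous_t[OF t e] by blast
  have "dist (Inf (prokhorov_radii \<mu> \<nu> s)) (Inf (prokhorov_radii \<mu> \<nu> t)) < e"
    if s: "0 < s" "dist s t < d" for s
  proof -
    \<comment> \<open>Monotonicity in time puts both values between those at \<open>t - d\<close>
      and \<open>t + d\<close>.\<close>
    have close: "N x y a \<le> N x y b + e/2"
      if "x \<in> Z" "y \<in> Z" "t - d \<le> a" "a \<le> t + d" "t - d \<le> b" "b \<le> t + d" for x y a b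
      using that d mono_t[of x y a "t + d"] mono_t[of x y "t - d" b] by fastforce
    have "Inf (prokhorov_radii \<mu> \<nu> s) \<le> Inf (prokhorov_radii \<mu> \<nu> t) + e/2"
      "Inf (prokhorov_radii \<mu> \<nu> t) \<le> Inf (prokhorov_radii \<mu> \<nu> s) + e/2"
      using Inf_prokhorov_radii_perturb[OF \<mu> \<nu> t \<open>0 < s\<close>, of "e/2"]
        Inf_prokhorov_radii_perturb[OF \<mu> \<nu> \<open>0 < s\<close> t, of "e/2"] close s d e
      by (simp_all add: dist_real_def)
    then show ?thesis using \<open>0 < e\<close> unfolding dist_real_def by linarith
  qed
  with d show "\<exists>d>0. \<forall>s\<in>{0<..}. dist s t < d \<longrightarrow>
      dist (Inf (prokhorov_radii \<mu> \<nu> s)) (Inf (prokhorov_radii \<mu> \<nu> t)) < e"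
    by auto
qed

end

theorem theorem3p5:
  fixes X :: "'a set" and M :: "'a \<Rightarrow> 'a \<Rightarrow> real \<Rightarrow> real"
  assumes "fuzzy_metric_space X M"
    and "compact_space (fuzzy_topology X M)"
  shows "fuzzy_metric_space (borel_probs X M) (fuzzy_prokhorov X M)"
proof -
  interpret compact_fuzzy_metric_space X M
    using assms by (simp add: compact_fuzzy_metric_space_def compact_fuzzy_metric_space_axioms_def)
  show ?thesis
  proof
    fix \<mu> \<nu> :: "'a measure" and t :: real
    assume \<mu>: "\<mu> \<in> borel_probs X M" and \<nu>: "\<nu> \<in> borel_probs X M"
    show "continuous_on {0<..} (fuzzy_prokhorov X M \<mu> \<nu>)"
      unfolding fuzzy_prokhorov_radii
      by (intro continuous_intros continuous_Inf_prokhorov_radii \<mu> \<nu>)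
    assume t: "0 < t"
    show "fuzzy_prokhorov X M \<mu> \<nu> t \<in> {0..1}" "0 < fuzzy_prokhorov X M \<mu> \<nu> t"
      using Inf_prokhorov_radii_bounds[OF \<mu> \<nu> t] by (auto simp: fuzzy_prokhorov_radii)
    show "fuzzy_prokhorov X M \<mu> \<nu> t = 1 \<longleftrightarrow> \<mu> = \<nu>"
      using eq_if_Inf_prokhorov_radii_eq_0[OF \<mu> \<nu> t] Inf_prokhorov_radii_self[OF \<mu> t]
      by (auto simp: fuzzy_prokhorov_radii)
    show "fuzzy_prokhorov X M \<mu> \<nu> t = fuzzy_prokhorov X M \<nu> \<mu> t"
      by (simp add: fuzzy_prokhorov_radii prokhorov_radii_commute)
  next
    fix \<mu> \<nu> \<kappa> :: "'a measure" and s t :: real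
    assume asm: "\<mu> \<in> borel_probs X M" "\<nu> \<in> borel_probs X M" "\<kappa> \<in> borel_probs X M" "0 < s" "0 < t"
    \<comment> \<open>The bound \<open>Inf < 1\<close> settles the case where the t-norm is
      truncated to 0; the triangle inequality for the infima settles the other.\<close>
    then show "lukasiewicz (fuzzy_prokhorov X M \<mu> \<nu> t) (fuzzy_prokhorov X M \<nu> \<kappa> s)
        \<le> fuzzy_prokhorov X M \<mu> \<kappa> (t + s)"
      using Inf_prokhorov_radii_triangle[OF asm(1-3,5,4)]
        Inf_prokhorov_radii_bounds(2)[OF asm(1,3), of "t + s"]
      by (simp add: fuzzy_prokhorov_radii lukasiewicz_def)
  qed
qed

end
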